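(* Let $G$ be a finite group, $H\subset G$ a subgroup and $\gamma\in Z^2(H,k^* )$ a normalised 2-cocycle. The character of the trivialising algebra $A(H,\gamma)$ in $\mathcal{Z}(G)$ has the form $$\chi_{A(H,\gamma)}(f,g)=\frac{1}{|H|}\sum_{\substack{x\in G\\ xfx^{-1},\,xgx^{-1}\in H}}\gamma(xfx^{-1}\,|\,xgx^{-1}),$$ for commuting $f,g\in G$, where $\gamma(u|v)=\gamma(u,v)\gamma(v,u)^{-1}$ for commuting $u,v\in H$.
   Context: $k$ is an algebraically closed field of characteristic zero. For a finite group $G$ with unit $e$, $\mathcal{Z}(G)$ is the braided monoidal category of finite-dimensional $G$-graded $k$-vector spaces $X=\bigoplus_{g\in G}X_g$ with a linear $G$-action satisfying $f(X_g)=X_{fgf^{-1}}$; morphisms preserve grading and action, the tensor product is the graded tensor product with diagonal action, and the braiding is $c_{X,Y}(x\otimes y)=f(y)\otimes x$ for $x\in X_f$, $y\in Y$. The character of an object $X$ of $\mathcal{Z}(G)$ is the function on pairs of commuting elements of $G$ given by $\chi_X(f,g)=\mathrm{tr}_{X_f}(g)$, the trace of the action of $g$ on $X_f$. A 2-cocycle $\gamma$ is normalised if $\gamma(e,g)=\gamma(f,e)=1$. For $\gamma\in Z^2(H,k^* )$ put $\varepsilon_h(f)=\gamma(h,f)\gamma(hfh^{-1},h)^{-1}$ for $h,f\in H$. The algebra $A(H,\gamma)$ in $\mathcal{Z}(G)$ is the vector space spanned by symbols $a_{g,f}$, $g\in G$, $f\in H$, modulo the relations $a_{gh,f}=\varepsilon_h(f)\,a_{g,hfh^{-1}}$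 for all $h\in H$, with $G$-grading $|a_{g,f}|=gfg^{-1}$, $G$-action $g'(a_{g,f})=a_{g'g,f}$, and multiplication determined by $a_{g,f}a_{g,f'}=\gamma(f,f')a_{g,ff'}$ and $a_{g,f}a_{g',f'}=0$ if $gH\neq g'H$. It is trivialising: it is a separable indecomposable commutative algebra whose category of local modules in $\mathcal{Z}(G)$ is equivalent to the category of finite-dimensional vector spaces. (A right module $M$ over a commutative algebra $A$ is local if its action map $M\otimes A\to M$ is unchanged by precomposition with the double braiding of $M$ and $A$.)
   Formalization: The arguments of γ( | ) are exchanged: the sum is over γ(xgx⁻¹ | xfx⁻¹). As printed the formula is false: for G=H=Z/3×Z/3, γ((a,b),(c,d))=ω^{ad} with ω a primitive cube root of unity, f=(1,0), g=(0,1), the character is ω⁻¹ but the printed sum is ω. *)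

theory Defs
  imports "Jordan_Normal_Form.VS_Connect" "HOL-Algebra.QuotRing"
begin

text \<open>
  The ground field is a type \<open>'k\<close>, entering module records as \<^term>\<open>class_ring\<close>.
  As usual for \<^typ>\<open>('k, 'v) module\<close>, the ring multiplication and unit of a record play no role
  when it is regarded merely as a vector space; they are the structure maps of an algebra.
\<close>

record ('k, 'v, 'g) Z_record = "('k, 'v) module" +
  grade :: "'g \<Rightarrow> 'v set"
  act :: "'g \<Rightarrow> 'v \<Rightarrow> 'v"

locale Z_object = group G + vectorspace class_ring X
  for G (structure) and X :: "('k::field, 'v, 'g, 'm) Z_record_scheme" +
  assumes finite_dimensional: "fin_dim"
    and grade_subspace: "f \<in> carrier G \<Longrightarrow> subspace class_ring (grade X f) X"
    and grade_direct_sum: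
      "x \<in> carrier X \<Longrightarrow>
        \<exists>!c. c \<in> (\<Pi>\<^sub>E f\<in>carrier G. grade X f) \<and> x = (\<Oplus>\<^bsub>X\<^esub>f\<in>carrier G. c f)"
    and act_linear: "f \<in> carrier G \<Longrightarrow> linear_map class_ring X X (act X f)"
    and act_one: "x \<in> carrier X \<Longrightarrow> act X \<one> x = x"
    and act_mult:
      "\<lbrakk>f \<in> carrier G; g \<in> carrier G; x \<in> carrier X\<rbrakk> \<Longrightarrow> act X (f \<otimes> g) x = act X f (act X g x)"
    and act_grade:
      "\<lbrakk>f \<in> carrier G; g \<in> carrier G\<rbrakk> \<Longrightarrow> act X f ` grade X g = grade X (f \<otimes> g \<otimes> inv f)"

text \<open>The trace of an endomorphism \<open>T\<close> of a finite-dimensional space, read off from the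
  matrix \<open>c\<close> of \<open>T\<close> in some (equivalently, any) basis.\<close>

definition vs_trace :: "('k::field, 'v, 'm) module_scheme \<Rightarrow> ('v \<Rightarrow> 'v) \<Rightarrow> 'k" where
  "vs_trace V T = (THE t. \<exists>B c. finite B \<and> vectorspace.basis class_ring V B \<and>
     (\<forall>b\<in>B. T b = LinearCombinations.module.lincomb V (c b) B) \<and> t = (\<Sum>b\<in>B. c b b))"

definition character :: "('k::field, 'v, 'g, 'm) Z_record_scheme \<Rightarrow> 'g \<Rightarrow> 'g \<Rightarrow> 'k" where
  "character X f g = vs_trace (X\<lparr>carrier := grade X f\<rparr>) (act X g)"

definition normalised_2cocycle ::
    "('g, 'a) monoid_scheme \<Rightarrow> 'g set \<Rightarrow> ('g \<Rightarrow> 'g \<Rightarrow> 'k::field) \<Rightarrow> bool" where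
  "normalised_2cocycle G H \<gamma> \<longleftrightarrow>
     (\<forall>f\<in>H. \<forall>g\<in>H. \<gamma> f g \<noteq> 0) \<and>
     (\<forall>f\<in>H. \<forall>g\<in>H. \<forall>h\<in>H. \<gamma> f g * \<gamma> (f \<otimes>\<^bsub>G\<^esub> g) h = \<gamma> f (g \<otimes>\<^bsub>G\<^esub> h) * \<gamma> g h) \<and>
     (\<forall>g\<in>H. \<gamma> \<one>\<^bsub>G\<^esub> g = 1 \<and> \<gamma> g \<one>\<^bsub>G\<^esub> = 1)"

definition conj_by :: "('g, 'a) monoid_scheme \<Rightarrow> 'g \<Rightarrow> 'g \<Rightarrow> 'g" where
  "conj_by G x f = x \<otimes>\<^bsub>G\<^esub> f \<otimes>\<^bsub>G\<^esub> inv\<^bsub>G\<^esub> x"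

definition eps ::
    "('g, 'a) monoid_scheme \<Rightarrow> ('g \<Rightarrow> 'g \<Rightarrow> 'k::field) \<Rightarrow> 'g \<Rightarrow> 'g \<Rightarrow> 'k" where
  "eps G \<gamma> h f = \<gamma> h f * inverse (\<gamma> (conj_by G h f) h)"

text \<open>
  This is \<open>\<gamma>(u|v)\<close>, used for commuting \<open>u\<close> and \<open>v\<close> only. Then it equals \<open>\<epsilon>\<^sub>u(v)\<close>, the scalar by which
  conjugation with \<open>u\<close> in the twisted group algebra multiplies the basis element of \<open>v\<close>. So when \<open>g\<close>
  acts on the component of degree \<open>f\<close>, the conjugate of the acting element \<open>g\<close> is the first argument.
\<close>

definition bichar :: "('g \<Rightarrow> 'g \<Rightarrow> 'k::field) \<Rightarrow> 'g \<Rightarrow> 'g \<Rightarrow> 'k" where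
  "bichar \<gamma> u v = \<gamma> u v * inverse (\<gamma> v u)"

definition symb :: "'g \<Rightarrow> 'g \<Rightarrow> 'g \<times> 'g \<Rightarrow> 'k::field" where
  "symb g f = (\<lambda>p. if p = (g, f) then 1 else 0)"

text \<open>
  The product of two symbols when \<open>g' = g h\<close> with \<open>h \<in> H\<close>: rewriting the second factor as
  \<open>\<epsilon>\<^sub>h(f') a\<^bsub>g, h f' h\<^sup>-\<^sup>1\<^esub>\<close> brings both factors over the same \<open>g\<close>, where
  \<open>a\<^bsub>g,f\<^esub> a\<^bsub>g,f'\<^esub> = \<gamma>(f,f') a\<^bsub>g,ff'\<^esub>\<close> applies.
\<close>

definition symb_mult ::
    "('g, 'a) monoid_scheme \<Rightarrow> 'g set \<Rightarrow> ('g \<Rightarrow> 'g \<Rightarrow> 'k::field)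
      \<Rightarrow> 'g \<times> 'g \<Rightarrow> 'g \<times> 'g \<Rightarrow> 'g \<times> 'g \<Rightarrow> 'k" where
  "symb_mult G H \<gamma> = (\<lambda>(g, f) (g', f').
     let h = inv\<^bsub>G\<^esub> g \<otimes>\<^bsub>G\<^esub> g'; s = conj_by G h f'
     in if h \<in> H then (\<lambda>p. eps G \<gamma> h f' * \<gamma> f s * symb g (f \<otimes>\<^bsub>G\<^esub> s) p) else (\<lambda>p. 0))"

text \<open>
  The space with basis the symbols, as functions supported on \<open>G \<times> H\<close>. The multiplication
  is the bilinear extension of \<^const>\<open>symb_mult\<close>. Since \<open>a\<^bsub>gh,e\<^esub> = a\<^bsub>g,e\<^esub>\<close> in the quotient,
  its unit \<open>\<Sum>\<^bsub>gH \<in> G/H\<^esub> a\<^bsub>g,e\<^esub>\<close> is represented by the average below.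
\<close>

definition symb_space ::
    "('g, 'a) monoid_scheme \<Rightarrow> 'g set \<Rightarrow> ('g \<Rightarrow> 'g \<Rightarrow> 'k::field_char_0)
      \<Rightarrow> ('k, 'g \<times> 'g \<Rightarrow> 'k) module" where
  "symb_space G H \<gamma> =
    \<lparr>carrier = {v. \<forall>p. p \<notin> carrier G \<times> H \<longrightarrow> v p = 0},
     mult = (\<lambda>v w p. \<Sum>q\<in>carrier G \<times> H. \<Sum>r\<in>carrier G \<times> H. v q * w r * symb_mult G H \<gamma> q r p),
     one = (\<lambda>(g, f). if g \<in> carrier G \<and> f = \<one>\<^bsub>G\<^esub> then 1 / of_nat (card H) else 0),
     zero = (\<lambda>p. 0),
     add = (\<lambda>v w p. v p + w p),
     smult = (\<lambda>c v p. c * v p)\<rparr>"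

definition relators ::
    "('g, 'a) monoid_scheme \<Rightarrow> 'g set \<Rightarrow> ('g \<Rightarrow> 'g \<Rightarrow> 'k::field) \<Rightarrow> ('g \<times> 'g \<Rightarrow> 'k) set" where
  "relators G H \<gamma> =
    {(\<lambda>p. symb (g \<otimes>\<^bsub>G\<^esub> h) f p - eps G \<gamma> h f * symb g (conj_by G h f) p) | g h f.
       g \<in> carrier G \<and> h \<in> H \<and> f \<in> H}"

definition relation_space ::
    "('g, 'a) monoid_scheme \<Rightarrow> 'g set \<Rightarrow> ('g \<Rightarrow> 'g \<Rightarrow> 'k::field_char_0)
      \<Rightarrow> ('g \<times> 'g \<Rightarrow> 'k) set" where
  "relation_space G H \<gamma> = LinearCombinations.module.span class_ring (symb_space G H \<gamma>) (relators G H \<gamma>)"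

definition quot_module ::
    "('k::field, 'v, 'm) module_scheme \<Rightarrow> 'v set \<Rightarrow> ('k, 'v set) module" where
  "quot_module V W =
    \<lparr>carrier = a_rcosets\<^bsub>V\<^esub> W,
     mult = rcoset_mult V W,
     one = W +>\<^bsub>V\<^esub> \<one>\<^bsub>V\<^esub>,
     zero = W,
     add = set_add V,
     smult = (\<lambda>c C. \<Union>v\<in>C. W +>\<^bsub>V\<^esub> (c \<odot>\<^bsub>V\<^esub> v))\<rparr>"

definition agen ::
    "('g, 'a) monoid_scheme \<Rightarrow> 'g set \<Rightarrow> ('g \<Rightarrow> 'g \<Rightarrow> 'k::field_char_0)
      \<Rightarrow> 'g \<Rightarrow> 'g \<Rightarrow> ('g \<times> 'g \<Rightarrow> 'k) set" where
  "agen G H \<gamma> g f = relation_space G H \<gamma> +>\<^bsub>symb_space G H \<gamma>\<^esub> symb g f"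

text \<open>
  The action of \<open>u\<close> is induced by \<open>(u v)(g, f) = v (u\<^sup>-\<^sup>1 g, f)\<close>, which sends the symbol at \<open>(g, f)\<close>
  to the one at \<open>(u g, f)\<close>.
\<close>

definition A_alg ::
    "('g, 'a) monoid_scheme \<Rightarrow> 'g set \<Rightarrow> ('g \<Rightarrow> 'g \<Rightarrow> 'k::field_char_0)
      \<Rightarrow> ('k, ('g \<times> 'g \<Rightarrow> 'k) set, 'g) Z_record" where
  "A_alg G H \<gamma> = module.extend (quot_module (symb_space G H \<gamma>) (relation_space G H \<gamma>))
    \<lparr>grade = (\<lambda>u. LinearCombinations.module.span class_ring (quot_module (symb_space G H \<gamma>) (relation_space G H \<gamma>))
       {agen G H \<gamma> g f | g f. g \<in> carrier G \<and> f \<in> H \<and> conj_by G g f = u}),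
     act = (\<lambda>u C. \<Union>v\<in>C. relation_space G H \<gamma> +>\<^bsub>symb_space G H \<gamma>\<^esub>
       (\<lambda>(g, f). if g \<in> carrier G then v (inv\<^bsub>G\<^esub> u \<otimes>\<^bsub>G\<^esub> g, f) else 0))\<rparr>"

end

theory Submission
  imports Defs
begin

text \<open>
  If \<open>id = (\<Sum>i. b i \<otimes> \<phi> i)\<close> on a finite-dimensional space, with vectors \<open>b i\<close> and functionals
  \<open>\<phi> i\<close>, then \<open>tr T = (\<Sum>i. \<phi> i (T (b i)))\<close>, also when the \<open>b i\<close> are linearly dependent.
  The component of degree \<open>f\<close> has such a decomposition indexed by all \<open>x \<in> G\<close> with
  \<open>x f x\<^sup>-\<^sup>1 \<in> H\<close>: take the symbol \<open>a\<close> at \<open>(x\<^sup>-\<^sup>1, x f x\<^sup>-\<^sup>1)\<close> and \<open>1/|H|\<close> times the coefficient at this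
  symbol. This coefficient is \<open>\<epsilon>\<^bsub>x y\<^esub>(t)\<close> on \<open>a\<^bsub>y,t\<^esub>\<close> of degree \<open>f\<close> with \<open>x y \<in> H\<close> and \<open>0\<close> on the other
  symbols; it respects the relations because \<open>\<epsilon>\<^bsub>kh\<^esub>(t) = \<epsilon>\<^sub>k(h t h\<^sup>-\<^sup>1) \<epsilon>\<^sub>h(t)\<close>.
  Since \<open>g\<close> moves the symbol at \<open>x\<^sup>-\<^sup>1\<close> to the one at \<open>g x\<^sup>-\<^sup>1\<close>, the trace is the stated sum over \<open>x\<close>,
  without a choice of coset representatives.
\<close>

subsection \<open>Traces from decompositions of the identity\<close>

text \<open>Stated for a bare function that is additive and homogeneous on the carrier, so that it
  serves both for a functional and for its composite with an endomorphism.\<close>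

lemma functional_finsum:
  fixes V :: "('k::field, 'v, 'm) module_scheme" and c :: "'i \<Rightarrow> 'k"
  assumes V: "module class_ring V"
    and add: "\<And>u v. \<lbrakk>u \<in> carrier V; v \<in> carrier V\<rbrakk> \<Longrightarrow> \<phi> (u \<oplus>\<^bsub>V\<^esub> v) = \<phi> u + \<phi> v"
    and smult: "\<And>a v. v \<in> carrier V \<Longrightarrow> \<phi> (a \<odot>\<^bsub>V\<^esub> v) = a * \<phi> v"
    and A: "finite A" "b \<in> A \<rightarrow> carrier V"
  shows "\<phi> (\<Oplus>\<^bsub>V\<^esub>i\<in>A. c i \<odot>\<^bsub>V\<^esub> b i) = (\<Sum>i\<in>A. c i * \<phi> (b i))"
proof -
  interpret Module.module class_ring V by fact
  have zero: "\<phi> \<zero>\<^bsub>V\<^esub> = 0"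
    using smult[of "\<zero>\<^bsub>V\<^esub>" 0] smult_l_null[of "\<zero>\<^bsub>V\<^esub>"] by simp
  show ?thesis
    using A
  proof (induction A rule: finite_induct)
    case empty
    then show ?case by (simp add: zero)
  next
    case (insert i A)
    then have "(\<lambda>i. c i \<odot>\<^bsub>V\<^esub> b i) \<in> A \<rightarrow> carrier V" and "b i \<in> carrier V"
      by auto
    with insert show ?case
      by (simp add: add smult finsum_closed)
  qed
qed

lemma finsum_smult_const:
  fixes V :: "('k::field, 'v, 'm) module_scheme" and c :: "'i \<Rightarrow> 'k"
  assumes V: "module class_ring V" and A: "finite A" and v: "v \<in> carrier V"
  shows "(\<Oplus>\<^bsub>V\<^esub>i\<in>A. c i \<odot>\<^bsub>V\<^esub> v) = (\<Sum>i\<in>A. c i) \<odot>\<^bsub>V\<^esub> v"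
proof -
  interpret Module.module class_ring V by fact
  show ?thesis
    using A
  proof (induction A rule: finite_induct)
    case empty
    then show ?case using v smult_l_null[of v] by simp
  next
    case (insert i A)
    then show ?case using v smult_l_distr[of "c i" "sum c A" v] by simp
  qed
qed

text \<open>The coordinate row \<open>c\<close> is multiplied by the matrix \<open>a\<close>. This
  turns an expansion in arbitrary vectors into an expansion in a basis.\<close>

lemma finsum_smult_lincomb:
  fixes V :: "('k::field, 'v, 'm) module_scheme" and c :: "'i \<Rightarrow> 'k"
  assumes V: "module class_ring V" and I: "finite I" and B: "finite B" "B \<subseteq> carrier V"
  shows "(\<Oplus>\<^bsub>V\<^esub>i\<in>I. c i \<odot>\<^bsub>V\<^esub> LinearCombinations.module.lincomb V (a i) B) =
    LinearCombinations.module.lincomb V (\<lambda>b. \<Sum>i\<in>I. c i * a i b) B"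
proof -
  interpret Module.module class_ring V by fact
  show ?thesis
    using I
  proof (induction I rule: finite_induct)
    case empty
    \<comment> \<open>The empty sum requires the zero combination to vanish; it equals
      \<open>0\<close> times itself.\<close>
    have "lincomb (\<lambda>b. 0 * 0) B = 0 \<odot>\<^bsub>V\<^esub> lincomb (\<lambda>b. 0) B"
      using lincomb_smult[OF B(2), of "\<lambda>b. 0" 0] by simp
    moreover have "lincomb (\<lambda>b. 0) B \<in> carrier V"
      using B by simp
    ultimately show ?case using smult_l_null[of "lincomb (\<lambda>b. 0) B"] by simp
  next
    case (insert i I)
    have "lincomb (\<lambda>b. c i * a i b + (\<Sum>i\<in>I. c i * a i b)) B =
        lincomb (\<lambda>b. c i * a i b) B \<oplus>\<^bsub>V\<^esub> lincomb (\<lambda>b. \<Sum>i\<in>I. c i * a i b) B"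
      using lincomb_sum[OF B, of "\<lambda>b. c i * a i b" "\<lambda>b. \<Sum>i\<in>I. c i * a i b"] by simp
    moreover have "lincomb (\<lambda>b. c i * a i b) B = c i \<odot>\<^bsub>V\<^esub> lincomb (a i) B"
      using lincomb_smult[OF B(2), of "a i" "c i"] by simp
    ultimately show ?case
      using insert B by (simp add: Pi_def)
  qed
qed

text \<open>This is cyclicity of the trace. The hypothesis \<open>frame\<close> factors the identity
  through the free space on \<open>I\<close>, as the functionals followed by the vectors
  \<open>b i\<close>; moving one factor past \<open>T\<close> turns the trace on \<open>V\<close>
  into a sum of diagonal entries on that free space.\<close>

lemma vs_trace_frame:
  fixes V :: "('k::field, 'v, 'm) module_scheme" and \<phi> :: "'i \<Rightarrow> 'v \<Rightarrow> 'k"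
  assumes V: "vectorspace class_ring V"
    and T: "T \<in> LinearCombinations.module_hom class_ring V V"
    and add: "\<And>i u v. \<lbrakk>i \<in> I; u \<in> carrier V; v \<in> carrier V\<rbrakk> \<Longrightarrow> \<phi> i (u \<oplus>\<^bsub>V\<^esub> v) = \<phi> i u + \<phi> i v"
    and smult: "\<And>i a v. \<lbrakk>i \<in> I; v \<in> carrier V\<rbrakk> \<Longrightarrow> \<phi> i (a \<odot>\<^bsub>V\<^esub> v) = a * \<phi> i v"
    and I: "finite I" "b \<in> I \<rightarrow> carrier V"
    and frame: "\<And>v. v \<in> carrier V \<Longrightarrow> v = (\<Oplus>\<^bsub>V\<^esub>i\<in>I. \<phi> i v \<odot>\<^bsub>V\<^esub> b i)"
  shows "vs_trace V T = (\<Sum>i\<in>I. \<phi> i (T (b i)))"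
proof -
  interpret V: vectorspace class_ring V by fact
  have mV: "module class_ring V" ..
  have T_carrier: "T v \<in> carrier V" if "v \<in> carrier V" for v
    using LinearCombinations.module_hom_closed[OF T] that by auto
  have T_add: "T (u \<oplus>\<^bsub>V\<^esub> v) = T u \<oplus>\<^bsub>V\<^esub> T v" if "u \<in> carrier V" "v \<in> carrier V" for u v
    using LinearCombinations.module_hom_add[OF T] that by auto
  have T_smult: "T (a \<odot>\<^bsub>V\<^esub> v) = a \<odot>\<^bsub>V\<^esub> T v" if "v \<in> carrier V" for a v
    using LinearCombinations.module_hom_smult[OF T] that by auto
  have coords: "\<exists>!a. a \<in> B \<rightarrow>\<^sub>E UNIV \<and> V.lincomb a B = v"
    if "finite B" "V.basis B" "v \<in> carrier V" for B v
    using V.basis_criterion[of B] that V.basis_def[of B] by simp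
  have coords_ex: "\<exists>a. v = V.lincomb a B"
    if "finite B" "V.basis B" "v \<in> carrier V" for B v
  proof -
    from ex1_implies_ex[OF coords[OF that]] obtain a where "a \<in> B \<rightarrow>\<^sub>E UNIV \<and> V.lincomb a B = v" ..
    then have "V.lincomb a B = v" ..
    show ?thesis by (rule exI[of _ a]) (rule \<open>V.lincomb a B = v\<close>[symmetric])
  qed
  have trace: "t = (\<Sum>i\<in>I. \<phi> i (T (b i)))"
    if B: "finite B" "V.basis B"
      and c: "\<And>v. v \<in> B \<Longrightarrow> T v = V.lincomb (c v) B"
      and t: "t = (\<Sum>v\<in>B. c v v)" for B c t
  proof -
    have BV: "B \<subseteq> carrier V"
      using B V.basis_def by auto
    have "\<forall>i\<in>I. \<exists>a. b i = V.lincomb a B"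
    proof
      fix i assume "i \<in> I"
      with I(2) have "b i \<in> carrier V" by (rule Pi_mem)
      with B show "\<exists>a. b i = V.lincomb a B" by (rule coords_ex)
    qed
    then obtain \<psi> where \<psi>: "\<And>i. i \<in> I \<Longrightarrow> b i = V.lincomb (\<psi> i) B"
      unfolding bchoice_iff by blast
    \<comment> \<open>Expanding a basis vector \<open>v\<close> by the frame, and each
      \<open>b i\<close> by its coordinates \<open>\<psi> i\<close>, gives a second coordinate row
      of \<open>v\<close>; it agrees with the obvious one by uniqueness.\<close>
    have dual: "(\<Sum>i\<in>I. \<phi> i v * \<psi> i w) = (if w = v then 1 else 0)" if "v \<in> B" "w \<in> B" for v w
    proof -
      have vV: "v \<in> carrier V" using that BV by auto
      have "v = (\<Oplus>\<^bsub>V\<^esub>i\<in>I. \<phi> i v \<odot>\<^bsub>V\<^esub> V.lincomb (\<psi> i) B)"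
      proof -
        have "v = (\<Oplus>\<^bsub>V\<^esub>i\<in>I. \<phi> i v \<odot>\<^bsub>V\<^esub> b i)" by (rule frame[OF vV])
        also have "\<dots> = (\<Oplus>\<^bsub>V\<^esub>i\<in>I. \<phi> i v \<odot>\<^bsub>V\<^esub> V.lincomb (\<psi> i) B)"
          using BV by (intro V.finsum_cong2) (auto simp: \<psi>)
        finally show ?thesis .
      qed
      also have "\<dots> = V.lincomb (\<lambda>w. \<Sum>i\<in>I. \<phi> i v * \<psi> i w) B"
        by (rule finsum_smult_lincomb[OF mV I(1) B(1) BV])
      \<comment> \<open>Uniqueness of coordinates holds among functions that are
        \<open>undefined\<close> off \<open>B\<close>, hence the restriction.\<close>
      also have "\<dots> = V.lincomb (\<lambda>w\<in>B. \<Sum>i\<in>I. \<phi> i v * \<psi> i w) B"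
        by (rule V.lincomb_cong[OF refl BV]) auto
      finally have 1: "V.lincomb (\<lambda>w\<in>B. \<Sum>i\<in>I. \<phi> i v * \<psi> i w) B = v" by simp
      have "V.lincomb (\<lambda>w\<in>B. if w = v then 1 else 0) B = v"
      proof -
        have "V.lincomb (\<lambda>w\<in>B. if w = v then 1 else 0) B =
            (\<Oplus>\<^bsub>V\<^esub>w\<in>B. if v = w then w else \<zero>\<^bsub>V\<^esub>)"
          unfolding V.lincomb_def using BV V.smult_one V.smult_l_null
          by (intro V.finsum_cong2) auto
        also have "\<dots> = v"
          using V.M.finsum_singleton[OF that(1) B(1), of "\<lambda>w. w"] BV by auto
        finally show ?thesis .
      qed
      with 1 have "(\<lambda>w\<in>B. \<Sum>i\<in>I. \<phi> i v * \<psi> i w) = (\<lambda>w\<in>B. if w = v then 1 else 0)"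
        by (intro Uniq_D[OF ex1_iff_ex_Uniq[THEN iffD1, OF coords[OF B vV], THEN conjunct2]] conjI) auto
      from fun_cong[OF this, of w] show ?thesis using that by simp
    qed
    have "(\<Sum>i\<in>I. \<phi> i (T (b i))) = (\<Sum>i\<in>I. \<Sum>v\<in>B. \<psi> i v * (\<Sum>w\<in>B. c v w * \<phi> i w))"
    proof (rule sum.cong[OF refl])
      fix i assume i: "i \<in> I"
      have "\<phi> i (T (b i)) = (\<Sum>v\<in>B. \<psi> i v * \<phi> i (T v))"
        unfolding \<psi>[OF i] V.lincomb_def
        using functional_finsum[OF mV, of "\<lambda>v. \<phi> i (T v)" B "\<lambda>v. v"] i B BV
        by (auto simp: add smult T_add T_smult T_carrier)
      moreover have "\<phi> i (T v) = (\<Sum>w\<in>B. c v w * \<phi> i w)" if "v \<in> B" for v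
        unfolding c[OF that] V.lincomb_def
        using functional_finsum[OF mV, of "\<phi> i" B "\<lambda>v. v"] i B BV
        by (auto simp: add smult)
      ultimately show "\<phi> i (T (b i)) = (\<Sum>v\<in>B. \<psi> i v * (\<Sum>w\<in>B. c v w * \<phi> i w))"
        by simp
    qed
    also have "\<dots> = (\<Sum>v\<in>B. \<Sum>i\<in>I. \<Sum>w\<in>B. c v w * (\<phi> i w * \<psi> i v))"
      by (subst sum.swap) (simp add: sum_distrib_left algebra_simps)
    also have "\<dots> = (\<Sum>v\<in>B. \<Sum>w\<in>B. c v w * (\<Sum>i\<in>I. \<phi> i w * \<psi> i v))"
      by (simp add: sum_distrib_left sum.swap[where A = I and B = B])
    \<comment> \<open>By \<open>dual\<close> only the terms with \<open>w = v\<close> survive, the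
      diagonal entries of \<open>c\<close>.\<close>
    also have "\<dots> = t"
      unfolding t using B by (auto intro!: sum.cong simp: dual if_distrib cong: if_cong)
    finally show ?thesis by simp
  qed
  \<comment> \<open>The vectors \<open>b i\<close> span by \<open>frame\<close>, so a finite basis
    exists and the description in \<open>vs_trace\<close> has a witness.\<close>
  have "carrier V \<subseteq> V.span (b ` I)"
  proof
    fix v assume v: "v \<in> carrier V"
    have "b ` I \<subseteq> V.span (b ` I)" "b ` I \<subseteq> carrier V"
      using I by (auto intro!: V.in_own_span[THEN subsetD])
    then interpret S: LinearCombinations.submodule class_ring "V.span (b ` I)" V
      by (intro V.span_is_submodule)
    have sub: "(\<Oplus>\<^bsub>V\<^esub>i\<in>J. \<phi> i v \<odot>\<^bsub>V\<^esub> b i) \<in> V.span (b ` I)" if "J \<subseteq> I" for J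
      using finite_subset[OF that I(1)] that
    proof (induction J rule: finite_induct)
      case (insert i J)
      then have "(\<lambda>i. \<phi> i v \<odot>\<^bsub>V\<^esub> b i) \<in> J \<rightarrow> carrier V" "b i \<in> carrier V" "b i \<in> V.span (b ` I)"
        using \<open>b ` I \<subseteq> V.span (b ` I)\<close> Pi_mem[OF I(2)] by (auto intro!: V.smult_closed)
      with insert show ?case by simp
    qed simp
    note frame[OF v]
    also have "(\<Oplus>\<^bsub>V\<^esub>i\<in>I. \<phi> i v \<odot>\<^bsub>V\<^esub> b i) \<in> V.span (b ` I)"
      by (rule sub[OF order_refl])
    finally show "v \<in> V.span (b ` I)" .
  qed
  then have "V.fin_dim"
    unfolding V.fin_dim_def using I V.span_is_subset2[of "b ` I"]
    by (intro exI[of _ "b ` I"]) auto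
  then obtain B where B: "finite B" "V.basis B"
    using V.finite_basis_exists by blast
  have "\<forall>v\<in>B. \<exists>a. T v = V.lincomb a B"
  proof
    fix v assume "v \<in> B"
    with B(2) have "T v \<in> carrier V" by (auto simp: V.basis_def T_carrier)
    with B show "\<exists>a. T v = V.lincomb a B" by (rule coords_ex)
  qed
  then obtain c where c: "\<And>v. v \<in> B \<Longrightarrow> T v = V.lincomb (c v) B"
    unfolding bchoice_iff by blast
  show ?thesis
    unfolding vs_trace_def
  proof (rule the_equality)
    show "\<exists>B c. finite B \<and> V.basis B \<and> (\<forall>v\<in>B. T v = V.lincomb (c v) B) \<and>
        (\<Sum>i\<in>I. \<phi> i (T (b i))) = (\<Sum>v\<in>B. c v v)"
      by (rule exI[of _ B], rule exI[of _ c]) (intro conjI ballI B c trace[OF B c refl, symmetric])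
  next
    fix t
    assume "\<exists>B c. finite B \<and> V.basis B \<and> (\<forall>v\<in>B. T v = V.lincomb (c v) B) \<and> t = (\<Sum>v\<in>B. c v v)"
    then obtain B c where "finite B" "V.basis B" "\<forall>v\<in>B. T v = V.lincomb (c v) B" "t = (\<Sum>v\<in>B. c v v)"
      by blast
    then show "t = (\<Sum>i\<in>I. \<phi> i (T (b i)))"
      by (intro trace[of B c]) blast+
  qed
qed

text \<open>Two linear maps, the identity and the frame sum, agree on a submodule. A frame identity
  thus has to be checked on generators only.\<close>

lemma frame_submodule:
  fixes V :: "('k::field, 'v, 'm) module_scheme" and \<phi> :: "'i \<Rightarrow> 'v \<Rightarrow> 'k"
  assumes V: "module class_ring V"
    and add: "\<And>i u v. \<lbrakk>i \<in> I; u \<in> carrier V; v \<in> carrier V\<rbrakk> \<Longrightarrow> \<phi> i (u \<oplus>\<^bsub>V\<^esub> v) = \<phi> i u + \<phi> i v"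
    and smult: "\<And>i a v. \<lbrakk>i \<in> I; v \<in> carrier V\<rbrakk> \<Longrightarrow> \<phi> i (a \<odot>\<^bsub>V\<^esub> v) = a * \<phi> i v"
    and I: "finite I" "b \<in> I \<rightarrow> carrier V"
  shows "LinearCombinations.submodule class_ring
    {v \<in> carrier V. (\<Oplus>\<^bsub>V\<^esub>i\<in>I. \<phi> i v \<odot>\<^bsub>V\<^esub> b i) = v} V"
proof -
  interpret Module.module class_ring V by fact
  have b: "b i \<in> carrier V" if "i \<in> I" for i
    using I that by auto
  have P: "(\<lambda>i. c i \<odot>\<^bsub>V\<^esub> b i) \<in> I \<rightarrow> carrier V" for c
    using b by (auto intro!: smult_closed)
  have sum_add: "(\<Oplus>\<^bsub>V\<^esub>i\<in>I. \<phi> i (u \<oplus>\<^bsub>V\<^esub> v) \<odot>\<^bsub>V\<^esub> b i) =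
      (\<Oplus>\<^bsub>V\<^esub>i\<in>I. \<phi> i u \<odot>\<^bsub>V\<^esub> b i) \<oplus>\<^bsub>V\<^esub> (\<Oplus>\<^bsub>V\<^esub>i\<in>I. \<phi> i v \<odot>\<^bsub>V\<^esub> b i)"
    if "u \<in> carrier V" "v \<in> carrier V" for u v
  proof -
    have "(\<Oplus>\<^bsub>V\<^esub>i\<in>I. \<phi> i (u \<oplus>\<^bsub>V\<^esub> v) \<odot>\<^bsub>V\<^esub> b i) =
        (\<Oplus>\<^bsub>V\<^esub>i\<in>I. \<phi> i u \<odot>\<^bsub>V\<^esub> b i \<oplus>\<^bsub>V\<^esub> \<phi> i v \<odot>\<^bsub>V\<^esub> b i)"
      using that b smult_l_distr by (intro finsum_cong2) (auto simp: add)
    then show ?thesis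
      using finsum_addf[OF P P] by simp
  qed
  have sum_smult: "(\<Oplus>\<^bsub>V\<^esub>i\<in>I. \<phi> i (a \<odot>\<^bsub>V\<^esub> v) \<odot>\<^bsub>V\<^esub> b i) = a \<odot>\<^bsub>V\<^esub> (\<Oplus>\<^bsub>V\<^esub>i\<in>I. \<phi> i v \<odot>\<^bsub>V\<^esub> b i)"
    if "v \<in> carrier V" for a v
  proof -
    have "(\<Oplus>\<^bsub>V\<^esub>i\<in>I. \<phi> i (a \<odot>\<^bsub>V\<^esub> v) \<odot>\<^bsub>V\<^esub> b i) = (\<Oplus>\<^bsub>V\<^esub>i\<in>I. a \<odot>\<^bsub>V\<^esub> (\<phi> i v \<odot>\<^bsub>V\<^esub> b i))"
      using that b smult_assoc1 by (intro finsum_cong2) (auto simp: smult)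
    then show ?thesis
      using finsum_smult_ldistr[OF I(1) _ P, of a] by simp
  qed
  have zero: "\<phi> i \<zero>\<^bsub>V\<^esub> = 0" if "i \<in> I" for i
    using smult[OF that, of "\<zero>\<^bsub>V\<^esub>" 0] smult_l_null[of "\<zero>\<^bsub>V\<^esub>"] by simp
  have "(\<Oplus>\<^bsub>V\<^esub>i\<in>I. \<phi> i \<zero>\<^bsub>V\<^esub> \<odot>\<^bsub>V\<^esub> b i) = (\<Oplus>\<^bsub>V\<^esub>i\<in>I. \<zero>\<^bsub>V\<^esub>)"
    using b smult_l_null by (intro finsum_cong2) (auto simp: zero)
  then show ?thesis
    by (intro submodule.intro V) (auto simp: sum_add sum_smult)
qed

subsection \<open>Quotient modules\<close>

text \<open>The module laws are transported along a surjection that respects the operations. This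
  serves for the plain quotient and for its extension by grading and action, whose record types
  differ.\<close>

lemma module_image:
  fixes M :: "('a, 'b, 'm) module_scheme" and Q :: "('a, 'c, 'n) module_scheme"
  assumes M: "module R M"
    and carrier: "carrier Q = \<pi> ` carrier M"
    and add: "\<And>u v. \<lbrakk>u \<in> carrier M; v \<in> carrier M\<rbrakk> \<Longrightarrow> \<pi> u \<oplus>\<^bsub>Q\<^esub> \<pi> v = \<pi> (u \<oplus>\<^bsub>M\<^esub> v)"
    and smult: "\<And>a v. \<lbrakk>a \<in> carrier R; v \<in> carrier M\<rbrakk> \<Longrightarrow> a \<odot>\<^bsub>Q\<^esub> \<pi> v = \<pi> (a \<odot>\<^bsub>M\<^esub> v)"
    and zero: "\<zero>\<^bsub>Q\<^esub> = \<pi> \<zero>\<^bsub>M\<^esub>"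
  shows "module R Q"
proof -
  interpret M: Module.module R M by fact
  have neg: "\<exists>w\<in>carrier M. \<pi> (v \<oplus>\<^bsub>M\<^esub> w) = \<pi> \<zero>\<^bsub>M\<^esub>" if "v \<in> carrier M" for v
    using that M.M.r_neg by (intro bexI[of _ "\<ominus>\<^bsub>M\<^esub> v"]) auto
  have Q: "abelian_group Q"
    by (rule abelian_groupI) (auto simp: carrier add zero M.M.a_ac neg)
  show ?thesis
    by (rule moduleI[OF M.R.is_cring Q])
      (auto simp: carrier add smult M.smult_l_distr M.smult_r_distr M.smult_assoc1)
qed

text \<open>Closure under negatives comes from the scalar \<open>-1\<close>. The coset lemmas for
  abelian groups become available for submodules.\<close>

lemma submodule_abelian_subgroup:
  assumes "LinearCombinations.submodule R W V"
  shows "abelian_subgroup W V"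
proof -
  interpret W: LinearCombinations.submodule R W V by fact
  interpret Module.module R V by (rule W.module)
  have neg: "\<ominus>\<^bsub>V\<^esub> v \<in> W" if "v \<in> W" for v
  proof -
    have "(\<ominus>\<^bsub>R\<^esub> \<one>\<^bsub>R\<^esub>) \<odot>\<^bsub>V\<^esub> v \<in> W"
      using that by (intro W.smult_closed) simp_all
    then show ?thesis
      by (simp only: smult_minus_1[OF subsetD[OF W.subset that]])
  qed
  have "subgroup W (add_monoid V)"
  proof (rule M.add.subgroupI)
    show "W \<noteq> {}" using W.zero_closed by blast
  next
    fix u v assume "u \<in> W" "v \<in> W"
    then show "u \<oplus>\<^bsub>V\<^esub> v \<in> W" by (rule W.m_closed)
  next
    fix v assume "v \<in> W"
    then show "\<ominus>\<^bsub>V\<^esub> v \<in> W" by (rule neg)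
  qed (rule W.subset)
  then have "additive_subgroup W V"
    by (rule additive_subgroup.intro)
  moreover have "abelian_group V" ..
  ultimately show ?thesis
    by (rule abelian_subgroupI3)
qed

lemma coset_eq_iff:
  assumes "LinearCombinations.submodule R W V" "u \<in> carrier V" "v \<in> carrier V"
  shows "W +>\<^bsub>V\<^esub> u = W +>\<^bsub>V\<^esub> v \<longleftrightarrow> u \<ominus>\<^bsub>V\<^esub> v \<in> W"
proof -
  interpret abelian_subgroup W V by (rule submodule_abelian_subgroup[OF assms(1)])
  show ?thesis
    using a_rcos_module[OF assms(3,2)] a_rcos_self[OF assms(2)]
      a_repr_independence'[OF _ assms(3), of u] by (auto simp: a_minus_def)
qed

lemma coset_add:
  assumes "LinearCombinations.submodule R W V" "u \<in> carrier V" "v \<in> carrier V"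
  shows "(W +>\<^bsub>V\<^esub> u) <+>\<^bsub>V\<^esub> (W +>\<^bsub>V\<^esub> v) = W +>\<^bsub>V\<^esub> (u \<oplus>\<^bsub>V\<^esub> v)"
  by (rule abelian_subgroup.a_rcos_sum[OF submodule_abelian_subgroup[OF assms(1)] assms(2,3)])

text \<open>An additive map that preserves \<open>W\<close> sends a coset into a single coset, so
  all sets in the union coincide. Scalar multiplication and the group action on cosets are defined
  by such unions.\<close>

lemma coset_map:
  assumes W: "LinearCombinations.submodule R W V" and u: "u \<in> carrier V"
    and closed: "\<And>v. v \<in> carrier V \<Longrightarrow> S v \<in> carrier V"
    and add: "\<And>v w. \<lbrakk>v \<in> carrier V; w \<in> carrier V\<rbrakk> \<Longrightarrow> S (v \<oplus>\<^bsub>V\<^esub> w) = S v \<oplus>\<^bsub>V\<^esub> S w"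
    and W_closed: "\<And>w. w \<in> W \<Longrightarrow> S w \<in> W"
  shows "(\<Union>v\<in>W +>\<^bsub>V\<^esub> u. W +>\<^bsub>V\<^esub> S v) = W +>\<^bsub>V\<^esub> S u"
proof -
  interpret W: LinearCombinations.submodule R W V by fact
  interpret Module.module R V by (rule W.module)
  interpret abelian_subgroup W V by (rule submodule_abelian_subgroup[OF W])
  have "W +>\<^bsub>V\<^esub> S v = W +>\<^bsub>V\<^esub> S u" if "v \<in> W +>\<^bsub>V\<^esub> u" for v
  proof -
    from that obtain w where w: "w \<in> W" "v = w \<oplus>\<^bsub>V\<^esub> u"
      by (auto simp: a_r_coset_def')
    moreover from this have "w \<in> carrier V" using W.subset by auto
    ultimately have "S v \<ominus>\<^bsub>V\<^esub> S u = S w"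
      using u by (simp add: add closed a_minus_def M.a_assoc M.r_neg)
    then show ?thesis
      using coset_eq_iff[OF W, of "S v" "S u"] w u \<open>w \<in> carrier V\<close> W_closed closed by auto
  qed
  then show ?thesis
    using a_rcos_self[OF u] by blast
qed

subsection \<open>The algebra of a subgroup with a 2-cocycle\<close>

lemma class_cring: "cring (class_ring :: 'k::field ring)"
  by (intro domain.axioms(1) field.axioms(1) class_field)

locale cocycle_pair = group G
  for G (structure) and H :: "'g set" and \<gamma> :: "'g \<Rightarrow> 'g \<Rightarrow> 'k::field_char_0" +
  assumes finite_carrier: "finite (carrier G)"
    and subgroup_H: "subgroup H G"
    and cocycle: "normalised_2cocycle G H \<gamma>"
begin

section \<open>Conjugation, the subgroup and the scalars of the cocycle\<close>

lemmas H_closed [simp] = subgroup.mem_carrier[OF subgroup_H]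
lemmas H_mult [simp] = subgroup.m_closed[OF subgroup_H]
lemmas H_inv [simp] = subgroup.m_inv_closed[OF subgroup_H]

lemma finite_H: "finite H"
  using finite_carrier subgroup.subset[OF subgroup_H] finite_subset by blast

lemma card_H: "of_nat (card H) \<noteq> (0 :: 'k)"
  using finite_H subgroup.one_closed[OF subgroup_H] by auto

lemma conj_by_closed [simp]:
  "\<lbrakk>x \<in> carrier G; y \<in> carrier G\<rbrakk> \<Longrightarrow> conj_by G x y \<in> carrier G"
  by (simp add: conj_by_def)

lemma conj_by_H [simp]: "\<lbrakk>h \<in> H; k \<in> H\<rbrakk> \<Longrightarrow> conj_by G h k \<in> H"
  by (simp add: conj_by_def)

lemma conj_by_mult:
  "\<lbrakk>x \<in> carrier G; y \<in> carrier G; z \<in> carrier G\<rbrakk> \<Longrightarrow>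
    conj_by G (x \<otimes> y) z = conj_by G x (conj_by G y z)"
  by (simp add: conj_by_def inv_mult_group m_assoc)

lemma conj_by_one: "x \<in> carrier G \<Longrightarrow> conj_by G \<one> x = x"
  by (simp add: conj_by_def)

lemma conj_by_swap:
  "\<lbrakk>x \<in> carrier G; y \<in> carrier G\<rbrakk> \<Longrightarrow> conj_by G x y \<otimes> x = x \<otimes> y"
  by (simp add: conj_by_def m_assoc)

lemma mult_H_iff:
  assumes "x \<in> carrier G" "h \<in> H"
  shows "x \<otimes> h \<in> H \<longleftrightarrow> x \<in> H"
proof
  assume "x \<otimes> h \<in> H"
  then have "x \<otimes> h \<otimes> inv h \<in> H" using assms by simp
  then show "x \<in> H" using assms by (simp add: m_assoc)
qed (use assms in simp)

text \<open>Conjugation by \<open>k h\<close> in the twisted group algebra is the composite of conjugation by \<open>h\<close>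
  and conjugation by \<open>k\<close>.\<close>

lemma eps_mult:
  assumes k: "k \<in> H" and h: "h \<in> H" and t: "t \<in> H"
  shows "eps G \<gamma> (k \<otimes> h) t = eps G \<gamma> k (conj_by G h t) * eps G \<gamma> h t"
proof -
  have nz: "\<gamma> a b \<noteq> 0" if "a \<in> H" "b \<in> H" for a b
    using cocycle that by (auto simp: normalised_2cocycle_def)
  have coc: "\<gamma> a b * \<gamma> (a \<otimes> b) c = \<gamma> a (b \<otimes> c) * \<gamma> b c" if "a \<in> H" "b \<in> H" "c \<in> H" for a b c
    using cocycle that by (auto simp: normalised_2cocycle_def)
  define t' where "t' = conj_by G h t"
  define t'' where "t'' = conj_by G k t'"
  have H: "t' \<in> H" "t'' \<in> H"
    using k h t by (simp_all add: t'_def t''_def)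
  have t'h: "t' \<otimes> h = h \<otimes> t" and t''k: "t'' \<otimes> k = k \<otimes> t'"
    using k h t H by (simp_all add: t'_def t''_def conj_by_swap)
  \<comment> \<open>Pure elimination in the field: the hypotheses are the cocycle identity at
    \<open>(k, h, t)\<close>, \<open>(k, t', h)\<close> and \<open>(t'', k, h)\<close>. The factors
    \<open>a\<close> and \<open>q\<close> stand for \<open>\<gamma> k h\<close> and
    \<open>\<gamma> (k \<otimes> t') h\<close>, which cancel.\<close>
  have key: "b * inverse u = p * inverse s * (d * inverse r)"
    if "a * b = c * d" "p * q = c * r" "s * q = u * a"
      and nz: "a \<noteq> 0" "q \<noteq> 0" "s \<noteq> 0" "u \<noteq> 0" "r \<noteq> 0" for a b c d p q r s u :: 'k
  proof -
    have "(b * (s * r)) * (a * q) = (a * b) * (s * q) * r" by simp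
    also have "\<dots> = (c * r) * d * u * a" by (simp add: that(1,3))
    also have "\<dots> = (p * d * u) * (a * q)" by (simp add: that(2)[symmetric])
    finally have "b * (s * r) = p * d * u"
      using nz by simp
    then show ?thesis
      using nz by (simp add: field_simps)
  qed
  have "\<gamma> (k \<otimes> h) t * inverse (\<gamma> t'' (k \<otimes> h)) =
      \<gamma> k t' * inverse (\<gamma> t'' k) * (\<gamma> h t * inverse (\<gamma> t' h))"
  proof (rule key)
    show "\<gamma> k h * \<gamma> (k \<otimes> h) t = \<gamma> k (h \<otimes> t) * \<gamma> h t"
      using coc k h t by simp
    show "\<gamma> k t' * \<gamma> (k \<otimes> t') h = \<gamma> k (h \<otimes> t) * \<gamma> t' h"
      using coc[of k t' h] k h H by (simp add: t'h)
    show "\<gamma> t'' k * \<gamma> (k \<otimes> t') h = \<gamma> t'' (k \<otimes> h) * \<gamma> k h"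
      using coc[of t'' k h] k h H by (simp add: t''k)
  qed (use nz k h H in simp_all)
  moreover have "conj_by G (k \<otimes> h) t = t''"
    using k h t by (simp add: t'_def t''_def conj_by_mult)
  ultimately show ?thesis
    by (simp add: eps_def flip: t'_def t''_def)
qed

section \<open>The space of symbols and its quotient by the relations\<close>

abbreviation "V \<equiv> symb_space G H \<gamma>"
abbreviation "W \<equiv> relation_space G H \<gamma>"
abbreviation "Q \<equiv> quot_module V W"
abbreviation "A \<equiv> A_alg G H \<gamma>"

lemma symb_space_simps:
  "carrier V = {v. \<forall>p. p \<notin> carrier G \<times> H \<longrightarrow> v p = 0}"
  "\<zero>\<^bsub>V\<^esub> = (\<lambda>p. 0)"
  "v \<oplus>\<^bsub>V\<^esub> w = (\<lambda>p. v p + w p)"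
  "a \<odot>\<^bsub>V\<^esub> v = (\<lambda>p. a * v p)"
  by (simp_all add: symb_space_def)

lemma module_V: "module class_ring V"
proof (rule moduleI[OF class_cring])
  show "abelian_group V"
  proof (rule abelian_groupI)
    fix v assume "v \<in> carrier V"
    then show "\<exists>w\<in>carrier V. w \<oplus>\<^bsub>V\<^esub> v = \<zero>\<^bsub>V\<^esub>"
      by (intro bexI[of _ "\<lambda>p. - v p"]) (auto simp: symb_space_simps)
  qed (auto simp: symb_space_simps)
qed (auto simp: symb_space_simps algebra_simps)

lemma V_minus:
  assumes "u \<in> carrier V" "v \<in> carrier V"
  shows "u \<ominus>\<^bsub>V\<^esub> v = (\<lambda>p. u p - v p)"
proof -
  interpret V: Module.module class_ring V by (rule module_V)
  have "\<ominus>\<^bsub>V\<^esub> v = (\<lambda>p. - v p)"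
    using assms by (intro V.M.minus_equality) (auto simp: symb_space_simps)
  then show ?thesis
    by (simp add: a_minus_def symb_space_simps)
qed

lemma symb_closed [simp]: "\<lbrakk>y \<in> carrier G; t \<in> H\<rbrakk> \<Longrightarrow> symb y t \<in> carrier V"
  by (auto simp: symb_space_simps symb_def)

lemma relators_closed: "relators G H \<gamma> \<subseteq> carrier V"
  by (auto simp: relators_def symb_space_simps symb_def)

lemma submodule_W: "LinearCombinations.submodule class_ring W V"
  unfolding relation_space_def by (rule module.span_is_submodule[OF module_V relators_closed])

lemma relators_subset_W: "relators G H \<gamma> \<subseteq> W"
  unfolding relation_space_def by (rule module.in_own_span[OF module_V relators_closed])

text \<open>A linear property of \<open>W\<close> follows once it holds for the relators. Vanishing
  of the coefficients on \<open>W\<close> and invariance of \<open>W\<close> under translation are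
  both obtained this way.\<close>

lemma W_subsetI:
  assumes "relators G H \<gamma> \<subseteq> N" "LinearCombinations.submodule class_ring N V"
  shows "W \<subseteq> N"
  unfolding relation_space_def by (rule module.span_is_subset[OF module_V assms])

abbreviation "cl v \<equiv> W +>\<^bsub>V\<^esub> v"

lemma W_smult_closed: "w \<in> W \<Longrightarrow> a \<odot>\<^bsub>V\<^esub> w \<in> W"
  using LinearCombinations.submodule.smult_closed[OF submodule_W, of a w] by simp

lemma cl_smult:
  assumes "v \<in> carrier V"
  shows "(\<Union>u\<in>cl v. cl (a \<odot>\<^bsub>V\<^esub> u)) = cl (a \<odot>\<^bsub>V\<^esub> v)"
  using submodule_W assms
  by (rule coset_map) (auto simp: symb_space_simps algebra_simps intro: W_smult_closed[unfolded symb_space_simps])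

lemma cl_zero: "cl \<zero>\<^bsub>V\<^esub> = W"
proof -
  interpret abelian_subgroup W V by (rule submodule_abelian_subgroup[OF submodule_W])
  show ?thesis by (rule a_rcos_const) simp
qed

text \<open>Grading and action are added on top of \<open>Q\<close>, so \<open>A\<close> has the
  same linear operations and computations can be moved between the two records.\<close>

lemma A_simps:
  "carrier A = carrier Q" "add A = add Q" "zero A = zero Q" "smult A = smult Q"
  "carrier Q = cl ` carrier V" "zero Q = cl \<zero>\<^bsub>V\<^esub>"
  "grade A u = LinearCombinations.module.span class_ring Q
     {agen G H \<gamma> y t | y t. y \<in> carrier G \<and> t \<in> H \<and> conj_by G y t = u}"
  by (auto simp: A_alg_def quot_module_def module.extend_def cl_zero A_RCOSETS_def')

lemma cl_add_Q: "\<lbrakk>u \<in> carrier V; v \<in> carrier V\<rbrakk> \<Longrightarrow> cl u \<oplus>\<^bsub>Q\<^esub> cl v = cl (u \<oplus>\<^bsub>V\<^esub> v)"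
  using coset_add[OF submodule_W, of u v] by (simp add: quot_module_def)

lemma cl_smult_Q: "v \<in> carrier V \<Longrightarrow> a \<odot>\<^bsub>Q\<^esub> cl v = cl (a \<odot>\<^bsub>V\<^esub> v)"
  using cl_smult[of v a] by (simp add: quot_module_def)

lemma module_Q: "module class_ring Q"
  by (rule module_image[OF module_V, where \<pi> = "(+>\<^bsub>V\<^esub>) W"])
    (simp_all add: A_simps cl_add_Q cl_smult_Q)

lemma module_A: "module class_ring A"
  by (rule module_image[OF module_V, where \<pi> = "(+>\<^bsub>V\<^esub>) W"])
    (simp_all add: A_simps cl_add_Q cl_smult_Q)

lemma agen_closed [simp]: "\<lbrakk>y \<in> carrier G; t \<in> H\<rbrakk> \<Longrightarrow> agen G H \<gamma> y t \<in> carrier Q"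
  by (simp add: agen_def A_simps)

lemma agen_relation:
  assumes y: "y \<in> carrier G" and h: "h \<in> H" and t: "t \<in> H"
  shows "agen G H \<gamma> (y \<otimes> h) t = eps G \<gamma> h t \<odot>\<^bsub>Q\<^esub> agen G H \<gamma> y (conj_by G h t)"
proof -
  let ?s = "symb y (conj_by G h t)"
  have s: "?s \<in> carrier V" "eps G \<gamma> h t \<odot>\<^bsub>V\<^esub> ?s \<in> carrier V" "symb (y \<otimes> h) t \<in> carrier V"
    using y h t module.smult_closed[OF module_V, of "eps G \<gamma> h t" ?s] by simp_all
  have "(\<lambda>p. symb (y \<otimes> h) t p - eps G \<gamma> h t * ?s p) \<in> relators G H \<gamma>"
    using y h t by (auto simp: relators_def)
  then have "symb (y \<otimes> h) t \<ominus>\<^bsub>V\<^esub> (eps G \<gamma> h t \<odot>\<^bsub>V\<^esub> ?s) \<in> W"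
    using relators_subset_W V_minus[OF s(3,2)] by (auto simp: symb_space_simps)
  then show ?thesis
    using coset_eq_iff[OF submodule_W s(3,2)] cl_smult_Q[OF s(1)] by (simp add: agen_def)
qed

text \<open>The functional on symbols with value \<open>\<epsilon>\<^bsub>x y\<^esub>(t)\<close> at \<open>a\<^bsub>y,t\<^esub>\<close>: it reads off the
  coefficient after rewriting \<open>a\<^bsub>y,t\<^esub>\<close> over the representative \<open>x\<^sup>-\<^sup>1\<close> of the coset \<open>y H\<close>.\<close>

definition symb_coeff :: "'g \<Rightarrow> 'g \<Rightarrow> 'g \<times> 'g \<Rightarrow> 'k" where
  "symb_coeff f x = (\<lambda>(y, t). if x \<otimes> y \<in> H \<and> conj_by G y t = f then eps G \<gamma> (x \<otimes> y) t else 0)"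

definition coeff_V :: "'g \<Rightarrow> 'g \<Rightarrow> ('g \<times> 'g \<Rightarrow> 'k) \<Rightarrow> 'k" where
  "coeff_V f x v = (\<Sum>p\<in>carrier G \<times> H. v p * symb_coeff f x p)"

text \<open>Choosing a representative gives a total function on sets. On a coset, and for
  \<open>x\<close> in \<open>G\<close>, the value does not depend on the choice because
  \<open>coeff_V\<close> vanishes on \<open>W\<close>.\<close>

definition coeff_Q :: "'g \<Rightarrow> 'g \<Rightarrow> ('g \<times> 'g \<Rightarrow> 'k) set \<Rightarrow> 'k" where
  "coeff_Q f x C = coeff_V f x (SOME v. v \<in> carrier V \<and> C = cl v)"

lemma coeff_V_linear:
  "coeff_V f x (u \<oplus>\<^bsub>V\<^esub> v) = coeff_V f x u + coeff_V f x v"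
  "coeff_V f x (\<lambda>p. u p - v p) = coeff_V f x u - coeff_V f x v"
  "coeff_V f x (a \<odot>\<^bsub>V\<^esub> v) = a * coeff_V f x v"
  "coeff_V f x (\<lambda>p. a * v p) = a * coeff_V f x v"
  "coeff_V f x \<zero>\<^bsub>V\<^esub> = 0"
  by (simp_all add: coeff_V_def symb_space_simps sum.distrib sum_subtractf sum_distrib_left algebra_simps)

lemma coeff_V_symb:
  assumes "y \<in> carrier G" "t \<in> H"
  shows "coeff_V f x (symb y t) = symb_coeff f x (y, t)"
proof -
  have "coeff_V f x (symb y t) =
      (\<Sum>p\<in>carrier G \<times> H. if p = (y, t) then symb_coeff f x p else 0)"
    by (auto simp: coeff_V_def symb_def intro!: sum.cong)
  then show ?thesis
    using assms finite_carrier finite_H by simp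
qed

text \<open>Since \<open>x \<otimes> (y \<otimes> h) = x \<otimes> y \<otimes> h\<close>, both
  symbols of a relator lie over the same coset and in the same degree. So either both coefficients
  vanish, or \<open>eps_mult\<close> with \<open>k = x \<otimes> y\<close> makes them
  cancel.\<close>

lemma coeff_V_relator:
  assumes r: "r \<in> relators G H \<gamma>" and x: "x \<in> carrier G"
  shows "coeff_V f x r = 0"
proof -
  from r obtain y h t where y: "y \<in> carrier G" and h: "h \<in> H" and t: "t \<in> H"
    and r: "r = (\<lambda>p. symb (y \<otimes> h) t p - eps G \<gamma> h t * symb y (conj_by G h t) p)"
    by (auto simp: relators_def)
  have "x \<otimes> (y \<otimes> h) = x \<otimes> y \<otimes> h"
    using x y h by (simp add: m_assoc)
  then show ?thesis
    using x y h t
    by (simp add: r coeff_V_linear coeff_V_symb symb_coeff_def mult_H_iff conj_by_mult eps_mult)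
qed

lemma coeff_V_W:
  assumes x: "x \<in> carrier G" and w: "w \<in> W"
  shows "coeff_V f x w = 0"
proof -
  interpret V: Module.module class_ring V by (rule module_V)
  have "W \<subseteq> {v \<in> carrier V. coeff_V f x v = 0}"
    using relators_closed coeff_V_relator[OF _ x]
    by (intro W_subsetI submodule.intro module_V) (auto simp: coeff_V_linear)
  with w show ?thesis by auto
qed

lemma coeff_Q_cl:
  assumes x: "x \<in> carrier G" and v: "v \<in> carrier V"
  shows "coeff_Q f x (cl v) = coeff_V f x v"
proof -
  define u where "u = (SOME u. u \<in> carrier V \<and> cl v = cl u)"
  have u: "u \<in> carrier V \<and> cl v = cl u"
    unfolding u_def by (rule someI[of _ v]) (simp add: v)
  then have "(\<lambda>p. v p - u p) \<in> W"
    using coset_eq_iff[OF submodule_W, of v u] v V_minus[of v u] by simp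
  from coeff_V_W[OF x this] show ?thesis
    by (simp add: coeff_Q_def coeff_V_linear flip: u_def)
qed

lemma coeff_Q_linear:
  assumes "x \<in> carrier G" "C \<in> carrier Q"
  shows "D \<in> carrier Q \<Longrightarrow> coeff_Q f x (C \<oplus>\<^bsub>Q\<^esub> D) = coeff_Q f x C + coeff_Q f x D"
    and "coeff_Q f x (a \<odot>\<^bsub>Q\<^esub> C) = a * coeff_Q f x C"
proof -
  interpret V: Module.module class_ring V by (rule module_V)
  show "D \<in> carrier Q \<Longrightarrow> coeff_Q f x (C \<oplus>\<^bsub>Q\<^esub> D) = coeff_Q f x C + coeff_Q f x D"
    and "coeff_Q f x (a \<odot>\<^bsub>Q\<^esub> C) = a * coeff_Q f x C"
    using assms by (auto simp: A_simps cl_add_Q cl_smult_Q coeff_Q_cl coeff_V_linear)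
qed

lemma coeff_Q_agen:
  "\<lbrakk>x \<in> carrier G; y \<in> carrier G; t \<in> H\<rbrakk> \<Longrightarrow> coeff_Q f x (agen G H \<gamma> y t) = symb_coeff f x (y, t)"
  by (simp add: agen_def coeff_Q_cl coeff_V_symb)

section \<open>The action on cosets, induced by translating representatives\<close>

definition translate :: "'g \<Rightarrow> ('g \<times> 'g \<Rightarrow> 'k) \<Rightarrow> 'g \<times> 'g \<Rightarrow> 'k" where
  "translate u v = (\<lambda>(y, t). if y \<in> carrier G then v (inv u \<otimes> y, t) else 0)"

lemma translate_closed: "\<lbrakk>u \<in> carrier G; v \<in> carrier V\<rbrakk> \<Longrightarrow> translate u v \<in> carrier V"
  by (auto simp: translate_def symb_space_simps)

lemma translate_linear:
  "translate u (v \<oplus>\<^bsub>V\<^esub> w) = translate u v \<oplus>\<^bsub>V\<^esub> translate u w"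
  "translate u (a \<odot>\<^bsub>V\<^esub> v) = a \<odot>\<^bsub>V\<^esub> translate u v"
  "translate u \<zero>\<^bsub>V\<^esub> = \<zero>\<^bsub>V\<^esub>"
  by (auto simp: translate_def symb_space_simps)

lemma translate_symb:
  assumes "u \<in> carrier G" "y \<in> carrier G"
  shows "translate u (symb y t) = symb (u \<otimes> y) t"
proof -
  have "inv u \<otimes> z = y \<longleftrightarrow> z = u \<otimes> y" if "z \<in> carrier G" for z
    using assms that by (auto simp flip: m_assoc)
  then show ?thesis
    using assms by (auto simp: translate_def symb_def)
qed

text \<open>Left translation commutes with right multiplication by \<open>h\<close>, so it carries
  relators to relators.\<close>

lemma translate_W:
  assumes u: "u \<in> carrier G" and w: "w \<in> W"
  shows "translate u w \<in> W"
proof -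
  interpret V: Module.module class_ring V by (rule module_V)
  interpret W: LinearCombinations.submodule class_ring W V by (rule submodule_W)
  have "translate u r \<in> W" if r: "r \<in> relators G H \<gamma>" for r
  proof -
    from r obtain y h t where y: "y \<in> carrier G" and h: "h \<in> H" and t: "t \<in> H"
      and r: "r = (\<lambda>p. symb (y \<otimes> h) t p - eps G \<gamma> h t * symb y (conj_by G h t) p)"
      by (auto simp: relators_def)
    have "translate u r = (\<lambda>p. translate u (symb (y \<otimes> h) t) p -
        eps G \<gamma> h t * translate u (symb y (conj_by G h t)) p)"
      by (auto simp: r translate_def)
    also have "\<dots> = (\<lambda>p. symb ((u \<otimes> y) \<otimes> h) t p - eps G \<gamma> h t * symb (u \<otimes> y) (conj_by G h t) p)"
      using u y h by (simp add: translate_symb m_assoc)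
    also have "\<dots> \<in> relators G H \<gamma>"
      unfolding relators_def using u y h t by blast
    finally show ?thesis using relators_subset_W by auto
  qed
  then have "W \<subseteq> {v \<in> carrier V. translate u v \<in> W}"
    using relators_closed
    by (intro W_subsetI submodule.intro module_V) (auto simp: translate_linear)
  with w show ?thesis by auto
qed

lemma act_cl:
  assumes u: "u \<in> carrier G" and v: "v \<in> carrier V"
  shows "act A u (cl v) = cl (translate u v)"
proof -
  have "act A u (cl v) = (\<Union>w\<in>cl v. cl (translate u w))"
    by (simp add: A_alg_def module.extend_def translate_def)
  also have "\<dots> = cl (translate u v)"
    using submodule_W v translate_closed[OF u] translate_linear(1) translate_W[OF u] by (rule coset_map)
  finally show ?thesis .
qed

lemma act_linear:
  assumes u: "u \<in> carrier G" and C: "C \<in> carrier Q"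
  shows "D \<in> carrier Q \<Longrightarrow> act A u (C \<oplus>\<^bsub>Q\<^esub> D) = act A u C \<oplus>\<^bsub>Q\<^esub> act A u D"
    and "act A u (a \<odot>\<^bsub>Q\<^esub> C) = a \<odot>\<^bsub>Q\<^esub> act A u C"
    and "act A u C \<in> carrier Q"
proof -
  interpret V: Module.module class_ring V by (rule module_V)
  show "D \<in> carrier Q \<Longrightarrow> act A u (C \<oplus>\<^bsub>Q\<^esub> D) = act A u C \<oplus>\<^bsub>Q\<^esub> act A u D"
    and "act A u (a \<odot>\<^bsub>Q\<^esub> C) = a \<odot>\<^bsub>Q\<^esub> act A u C"
    and "act A u C \<in> carrier Q"
    using C u by (auto simp: A_simps cl_add_Q cl_smult_Q act_cl translate_linear translate_closed)
qed

lemma act_zero: "u \<in> carrier G \<Longrightarrow> act A u \<zero>\<^bsub>Q\<^esub> = \<zero>\<^bsub>Q\<^esub>"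
  using act_cl[of u "\<zero>\<^bsub>V\<^esub>"] translate_linear(3)[of u]
  by (simp add: A_simps) (simp add: symb_space_simps)

lemma act_agen:
  "\<lbrakk>u \<in> carrier G; y \<in> carrier G; t \<in> H\<rbrakk> \<Longrightarrow> act A u (agen G H \<gamma> y t) = agen G H \<gamma> (u \<otimes> y) t"
  by (simp add: agen_def act_cl translate_symb)

text \<open>Right multiplication by \<open>y\<close> is a bijection onto \<open>H\<close>. This
  count is what the factor 1/|H| in the frame compensates.\<close>

lemma coset_filter_card:
  assumes y: "y \<in> carrier G"
  shows "card {x \<in> carrier G. x \<otimes> y \<in> H} = card H"
proof (rule bij_betw_same_card)
  have "x = x \<otimes> y \<otimes> inv y" if "x \<in> carrier G" for x
    using y that by (simp add: m_assoc)
  moreover have "h \<otimes> inv y \<otimes> y = h" if "h \<in> H" for h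
    using y that by (simp add: m_assoc)
  ultimately show "bij_betw (\<lambda>x. x \<otimes> y) {x \<in> carrier G. x \<otimes> y \<in> H} H"
    using y by (intro bij_betw_byWitness[where f' = "\<lambda>h. h \<otimes> inv y"]) auto
qed

section \<open>The homogeneous components\<close>

lemma submodule_grade: "LinearCombinations.submodule class_ring (grade A f) Q"
  unfolding A_simps by (rule module.span_is_submodule[OF module_Q]) auto

lemma agen_grade: "\<lbrakk>y \<in> carrier G; t \<in> H; conj_by G y t = f\<rbrakk> \<Longrightarrow> agen G H \<gamma> y t \<in> grade A f"
  unfolding A_simps by (rule subsetD[OF module.in_own_span[OF module_Q]]) auto

lemma grade_subsetI:
  assumes "\<And>y t. \<lbrakk>y \<in> carrier G; t \<in> H; conj_by G y t = f\<rbrakk> \<Longrightarrow> agen G H \<gamma> y t \<in> N"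
    and "LinearCombinations.submodule class_ring N Q"
  shows "grade A f \<subseteq> N"
  unfolding A_simps using assms by (intro module.span_is_subset[OF module_Q]) auto

text \<open>In general \<open>g\<close> carries degree \<open>f\<close> to the degree
  \<open>conj_by G g f\<close>; for commuting elements this is \<open>f\<close> again, so
  \<open>g\<close> has a trace on this component.\<close>

lemma act_grade_closed:
  assumes f: "f \<in> carrier G" and g: "g \<in> carrier G" and comm: "f \<otimes> g = g \<otimes> f"
    and C: "C \<in> grade A f"
  shows "act A g C \<in> grade A f"
proof -
  interpret Q: Module.module class_ring Q by (rule module_Q)
  interpret S: LinearCombinations.submodule class_ring "grade A f" Q by (rule submodule_grade)
  have "conj_by G g f = f"
    using f g comm by (simp add: conj_by_def m_assoc flip: comm)
  then have "conj_by G (g \<otimes> y) t = f" if "y \<in> carrier G" "t \<in> H" "conj_by G y t = f" for y t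
    using that g by (simp add: conj_by_mult)
  then have "grade A f \<subseteq> {C \<in> carrier Q. act A g C \<in> grade A f}"
    using g by (intro grade_subsetI submodule.intro module_Q) (auto simp: act_agen agen_grade act_linear act_zero)
  with C show ?thesis by auto
qed

text \<open>By linearity it is enough to treat the class of a symbol at \<open>(y, t)\<close> of
  degree \<open>f\<close>. For each of the |H| elements \<open>x\<close> with
  \<open>x \<otimes> y\<close> in \<open>H\<close>, rewriting it over the representative
  \<open>inv x\<close> shows that the summand is 1/|H| times this class; the other summands
  vanish.\<close>

lemma grade_frame:
  fixes f
  defines "I \<equiv> {x \<in> carrier G. conj_by G x f \<in> H}"
    and "b \<equiv> \<lambda>x. agen G H \<gamma> (inv x) (conj_by G x f)"
    and "VS \<equiv> A\<lparr>carrier := grade A f\<rparr>"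
  assumes f: "f \<in> carrier G" and C: "C \<in> grade A f"
  shows "(\<Oplus>\<^bsub>VS\<^esub>x\<in>I. (coeff_Q f x C / of_nat (card H)) \<odot>\<^bsub>VS\<^esub> b x) = C"
proof -
  let ?\<phi> = "\<lambda>x C. coeff_Q f x C / of_nat (card H)"
  interpret Q: Module.module class_ring Q by (rule module_Q)
  interpret S: LinearCombinations.submodule class_ring "grade A f" Q by (rule submodule_grade)
  have VS_simps: "carrier VS = grade A f" "add VS = add Q" "zero VS = zero Q" "smult VS = smult Q"
    by (simp_all add: VS_def A_simps)
  have "LinearCombinations.submodule class_ring (grade A f) A"
    using S.subset by (intro submodule.intro module_A) (auto simp: A_simps(1-4))
  then have VS: "module class_ring VS"
    unfolding VS_def by (rule module.submodule_is_module[OF module_A])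
  interpret VS: Module.module class_ring VS by (rule VS)
  have I: "finite I"
    using finite_carrier by (simp add: I_def)
  \<comment> \<open>Conjugation by \<open>inv x\<close> takes \<open>conj_by G x f\<close> back to
    \<open>f\<close>, so \<open>b x\<close> has degree \<open>f\<close>.\<close>
  have b: "b \<in> I \<rightarrow> carrier VS"
    using f by (auto simp: I_def b_def VS_simps conj_by_one simp flip: conj_by_mult intro!: agen_grade)
  let ?N = "{C \<in> carrier VS. (\<Oplus>\<^bsub>VS\<^esub>x\<in>I. ?\<phi> x C \<odot>\<^bsub>VS\<^esub> b x) = C}"
  have "LinearCombinations.submodule class_ring ?N VS"
    using S.subset I b by (intro frame_submodule VS)
      (auto simp: VS_simps coeff_Q_linear I_def add_divide_distrib subset_iff)
  then interpret N: LinearCombinations.submodule class_ring ?N VS .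
  \<comment> \<open>The component is a span inside \<open>Q\<close>, so minimality of the span asks
    for a submodule of \<open>Q\<close> rather than of \<open>VS\<close>.\<close>
  have "LinearCombinations.submodule class_ring ?N Q"
    using S.subset N.m_closed N.zero_closed N.smult_closed
    by (intro submodule.intro module_Q) (auto simp: VS_simps)
  moreover have "agen G H \<gamma> y t \<in> ?N"
    if y: "y \<in> carrier G" and t: "t \<in> H" and yt: "conj_by G y t = f" for y t
  proof -
    let ?a = "agen G H \<gamma> y t"
    have a: "?a \<in> carrier VS"
      using that by (simp add: VS_simps agen_grade)
    have term_eq: "?\<phi> x ?a \<odot>\<^bsub>VS\<^esub> b x = (if x \<otimes> y \<in> H then 1 / of_nat (card H) else 0) \<odot>\<^bsub>VS\<^esub> ?a"
      if x: "x \<in> I" for x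
    proof (cases "x \<otimes> y \<in> H")
      case True
      have xG: "x \<in> carrier G" using x by (simp add: I_def)
      have "inv x \<otimes> (x \<otimes> y) = y"
        using xG y by (simp flip: m_assoc)
      moreover have "conj_by G (x \<otimes> y) t = conj_by G x f"
        using xG y t yt by (simp add: conj_by_mult)
      \<comment> \<open>This is the defining relation over \<open>inv x\<close> with
        \<open>h = x \<otimes> y\<close>.\<close>
      ultimately have "?a = eps G \<gamma> (x \<otimes> y) t \<odot>\<^bsub>Q\<^esub> b x"
        using agen_relation[OF _ True t, of "inv x"] xG by (simp add: b_def)
      moreover have "b x \<in> carrier Q"
        using b x S.subset by (auto simp: VS_simps)
      ultimately have "(1 / of_nat (card H)) \<odot>\<^bsub>Q\<^esub> ?a = (eps G \<gamma> (x \<otimes> y) t / of_nat (card H)) \<odot>\<^bsub>Q\<^esub> b x"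
        using Q.smult_assoc1[of "1 / of_nat (card H)" "eps G \<gamma> (x \<otimes> y) t" "b x"] by simp
      moreover have "coeff_Q f x ?a = eps G \<gamma> (x \<otimes> y) t"
        using True xG y t yt by (simp add: coeff_Q_agen symb_coeff_def)
      ultimately show ?thesis
        using True by (simp add: VS_simps)
    next
      case False
      have "b x \<in> carrier VS" using b x by auto
      then show ?thesis
        using False x y t a VS.smult_l_null[of "b x"] VS.smult_l_null[of ?a]
        by (simp add: I_def coeff_Q_agen symb_coeff_def)
    qed
    have "(\<Oplus>\<^bsub>VS\<^esub>x\<in>I. ?\<phi> x ?a \<odot>\<^bsub>VS\<^esub> b x) =
        (\<Oplus>\<^bsub>VS\<^esub>x\<in>I. (if x \<otimes> y \<in> H then 1 / of_nat (card H) else 0) \<odot>\<^bsub>VS\<^esub> ?a)"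
      using a Pi_mem[OF b] by (intro VS.finsum_cong2 refl term_eq) (auto intro!: VS.smult_closed)
    also have "\<dots> = (\<Sum>x\<in>I. if x \<otimes> y \<in> H then 1 / of_nat (card H) else 0) \<odot>\<^bsub>VS\<^esub> ?a"
      by (rule finsum_smult_const[OF VS I a])
    also have "(\<Sum>x\<in>I. if x \<otimes> y \<in> H then 1 / of_nat (card H) else 0) =
        (\<Sum>x\<in>{x \<in> carrier G. x \<otimes> y \<in> H}. 1 / of_nat (card H) :: 'k)"
    proof -
      \<comment> \<open>No such \<open>x\<close> is missing from \<open>I\<close>: its conjugate of
        \<open>f\<close> is the conjugate of \<open>t\<close> by \<open>x \<otimes> y\<close>, hence
        in \<open>H\<close>. The sum therefore has all |H| nonzero terms.\<close>
      have "conj_by G x f \<in> H" if "x \<in> carrier G" "x \<otimes> y \<in> H" for x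
        using that y t conj_by_mult[of x y t] conj_by_H[of "x \<otimes> y" t] by (simp add: yt)
      then have "{x \<in> carrier G. x \<otimes> y \<in> H} = {x \<in> I. x \<otimes> y \<in> H}"
        by (auto simp: I_def)
      then show ?thesis
        by (simp only: sum.inter_filter[OF I])
    qed
    also have "\<dots> = 1"
      using card_H by (simp add: coset_filter_card[OF y])
    finally show ?thesis
      using a VS.smult_one by simp
  qed
  ultimately have "grade A f \<subseteq> ?N"
    by (intro grade_subsetI)
  with C show ?thesis by auto
qed

section \<open>The character as a sum over the group\<close>

lemma eps_commuting:
  "\<lbrakk>u \<in> carrier G; v \<in> carrier G; u \<otimes> v = v \<otimes> u\<rbrakk> \<Longrightarrow> eps G \<gamma> u v = bichar \<gamma> u v"
  by (simp add: eps_def bichar_def conj_by_def m_assoc)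

theorem character_A_alg:
  assumes f: "f \<in> carrier G" and g: "g \<in> carrier G" and comm: "f \<otimes> g = g \<otimes> f"
  shows "character A f g = 1 / of_nat (card H) *
    (\<Sum>x\<in>{x \<in> carrier G. conj_by G x f \<in> H \<and> conj_by G x g \<in> H}.
      bichar \<gamma> (conj_by G x g) (conj_by G x f))"
proof -
  let ?VS = "A\<lparr>carrier := grade A f\<rparr>"
  let ?I = "{x \<in> carrier G. conj_by G x f \<in> H}"
  let ?b = "\<lambda>x. agen G H \<gamma> (inv x) (conj_by G x f)"
  interpret S: LinearCombinations.submodule class_ring "grade A f" Q by (rule submodule_grade)
  have VS_simps: "carrier ?VS = grade A f" "add ?VS = add Q" "zero ?VS = zero Q" "smult ?VS = smult Q"
    by (simp_all add: A_simps)
  have "LinearCombinations.submodule class_ring (grade A f) A"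
    using S.subset by (intro submodule.intro module_A) (auto simp: A_simps(1-4))
  then have VS: "vectorspace class_ring ?VS"
    by (intro vectorspace.intro class_field module.submodule_is_module[OF module_A])
  have T: "act A g \<in> LinearCombinations.module_hom class_ring ?VS ?VS"
    using act_linear[OF g] act_grade_closed[OF f g comm] S.subset
    unfolding LinearCombinations.module_hom_def by (auto simp: VS_simps subset_iff)
  have b: "?b \<in> ?I \<rightarrow> carrier ?VS"
    using f by (auto simp: VS_simps conj_by_one simp flip: conj_by_mult intro!: agen_grade)
  have "character A f g = (\<Sum>x\<in>?I. coeff_Q f x (act A g (?b x)) / of_nat (card H))"
    unfolding character_def
  \<comment> \<open>The factor 1/|H| is put into the functionals, since the bare coefficients would
    recover each symbol |H| times.\<close>
  proof (rule vs_trace_frame[OF VS T, where \<phi> = "\<lambda>x C. coeff_Q f x C / of_nat (card H)"])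
    show "C = (\<Oplus>\<^bsub>?VS\<^esub>x\<in>?I. (coeff_Q f x C / of_nat (card H)) \<odot>\<^bsub>?VS\<^esub> ?b x)" if "C \<in> carrier ?VS" for C
      using grade_frame[OF f, of C] that by (simp add: VS_simps)
  qed (use finite_carrier b S.subset in
    \<open>auto simp: VS_simps coeff_Q_linear add_divide_distrib subset_iff\<close>)
  also have "\<dots> = (\<Sum>x\<in>?I. if conj_by G x g \<in> H then
      1 / of_nat (card H) * bichar \<gamma> (conj_by G x g) (conj_by G x f) else 0)"
  proof (rule sum.cong[OF refl])
    fix x assume "x \<in> ?I"
    then have x: "x \<in> carrier G" and xf: "conj_by G x f \<in> H" by auto
    have fc: "conj_by G g f = f"
      using f g comm by (simp add: conj_by_def m_assoc flip: comm)
    have hom: "conj_by G x (u \<otimes> v) = conj_by G x u \<otimes> conj_by G x v"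
      if "u \<in> carrier G" "v \<in> carrier G" for u v
    proof -
      have "inv x \<otimes> (x \<otimes> w) = w" if "w \<in> carrier G" for w
        using x that by (simp flip: m_assoc)
      then show ?thesis
        using x that by (simp add: conj_by_def m_assoc)
    qed
    \<comment> \<open>The translated symbol still has degree \<open>f\<close>, so membership of
      \<open>conj_by G x g\<close> in \<open>H\<close> alone decides which branch of
      \<open>symb_coeff\<close> applies.\<close>
    have "conj_by G (g \<otimes> inv x) (conj_by G x f) = f"
      using x f g fc by (simp add: conj_by_one m_assoc flip: conj_by_mult)
    moreover have "x \<otimes> (g \<otimes> inv x) = conj_by G x g"
      using x g by (simp add: conj_by_def m_assoc)
    \<comment> \<open>The subscript of \<open>eps\<close> is
      \<open>x \<otimes> (g \<otimes> inv x)\<close>, the conjugate of the acting element, which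
      therefore becomes the first argument of \<open>bichar\<close>. The two conjugates commute
      since conjugation by \<open>x\<close> is multiplicative.\<close>
    moreover have "eps G \<gamma> (conj_by G x g) (conj_by G x f) = bichar \<gamma> (conj_by G x g) (conj_by G x f)"
      using x f g comm by (intro eps_commuting) (simp_all flip: hom)
    ultimately show "coeff_Q f x (act A g (?b x)) / of_nat (card H) = (if conj_by G x g \<in> H then
        1 / of_nat (card H) * bichar \<gamma> (conj_by G x g) (conj_by G x f) else 0)"
      using x xf g by (simp add: act_agen coeff_Q_agen symb_coeff_def)
  qed
  also have "\<dots> = (\<Sum>x\<in>{x \<in> ?I. conj_by G x g \<in> H}.
      1 / of_nat (card H) * bichar \<gamma> (conj_by G x g) (conj_by G x f))"
    using finite_carrier by (intro sum.inter_filter[symmetric]) simp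
  finally show ?thesis
    by (simp add: sum_distrib_left conj_assoc)
qed

end

theorem corollary4p1p2:
  fixes G (structure) and H :: "'g set"
    and \<gamma> :: "'g \<Rightarrow> 'g \<Rightarrow> 'k::{alg_closed_field, field_char_0}"
  assumes "group G" and "finite (carrier G)" and "subgroup H G"
    and "normalised_2cocycle G H \<gamma>"
    and "f \<in> carrier G" and "g \<in> carrier G" and "f \<otimes> g = g \<otimes> f"
  shows "character (A_alg G H \<gamma>) f g =
    1 / of_nat (card H) *
      (\<Sum>x\<in>{x \<in> carrier G. conj_by G x f \<in> H \<and> conj_by G x g \<in> H}.
        bichar \<gamma> (conj_by G x g) (conj_by G x f))"
proof -
  interpret cocycle_pair G H \<gamma>
    using assms(1-4) by (intro cocycle_pair.intro cocycle_pair_axioms.intro)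
  show ?thesis
    using assms(5-7) by (rule character_A_alg)
qed

end
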